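(* Let $(u_t,A_t,B_t)$ denote a solution, on a toric Fano manifold, of $$\frac{\partial}{\partial t}u=\log\det\big({\rm Hess}(u)+\sqrt{-1}e^{-2t}B_0\big)-2\Big(-u+\sum_{j=1}^mx_ju_{,j}\Big),\qquad A_t=e^{-2t}A_0,\qquad B_t=e^{-2t}B_0 .$$ The associated one-parameter family of potentials $\phi_t(y)$ on $\mathbb{R}^m$ (the Legendre transforms of $u_t$) satisfies $$\frac{\partial}{\partial t}\phi_t=\log\det\Big(\big({\rm Hess}(\phi_t)\big)^{-1}+\sqrt{-1}e^{-2t}B_0\Big)^{-1}+2\phi_t .$$
   Context: $\mathrm{P}=\{x\in\mathfrak{t}^*\cong\mathbb{R}^m:L_j(x)=\langle v_j,x\rangle+\lambda_j\ge0,\ j=1,\dots,d\}$ is the Delzant polytope of a compact toric symplectic manifold $(M,\omega_0,\mathbb{T})$ with $\omega_0\in2\pi c_1(M)$ (Fano condition, normalized so that $L_j(0)=1$ for all $j$). $\mathcal{S}(\mathrm{P},\mathrm{L})$ is the set of continuous $u:\mathrm{P}\to\mathbb{R}$, smooth and strictly convex on $\mathring{\mathrm{P}}$ and on the interior of each face, with $u-\tfrac12\sum_jL_j\log L_j$ smooth on $\mathrm{P}$. $A_0,B_0$ are constant real skew-symmetric $m\times m$ matrices. A solution is a smooth path $u_t\in\mathcal{S}(\mathrm{P},\mathrm{L})$ such that the Hermitian matrix ${\rm Hess}(u_t)+\sqrt{-1}e^{-2t}B_0$ is positive definite on $\mathring{\mathrm{P}}$ (which guarantees, together with an analogous condition on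 faces, that $(u_t,A_t,B_t)$ defines a toric generalized Kähler structure). For $u\in\mathcal{S}(\mathrm{P},\mathrm{L})$ the map $x\mapsto y=\nabla u(x)$ is a diffeomorphism $\mathring{\mathrm{P}}\to\mathbb{R}^m$, and the Legendre transform is the smooth strictly convex function $\phi$ on $\mathbb{R}^m$ with $\phi(y)+u(x)=\langle y,x\rangle$, $y=\nabla u(x)$. *)

theory Defs
  imports "HOL-Analysis.Analysis"
begin

subsection \<open>Smooth and strictly convex functions\<close>

primrec Ck_on :: "nat \<Rightarrow> ('a::euclidean_space \<Rightarrow> real) \<Rightarrow> 'a set \<Rightarrow> bool" where
  "Ck_on 0 f U \<longleftrightarrow> continuous_on U f"
| "Ck_on (Suc k) f U \<longleftrightarrow>
     (\<forall>x\<in>U. f differentiable (at x)) \<and>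
     (\<forall>b\<in>Basis. Ck_on k (\<lambda>x. frechet_derivative f (at x) b) U)"

text \<open>
  On a set that need not be open (a polytope, the relative interior of a face, a time interval
  with end points), smooth means: near each point the function is the restriction of a smooth
  function on an open set.
\<close>

definition smooth_on :: "'a::euclidean_space set \<Rightarrow> ('a \<Rightarrow> real) \<Rightarrow> bool" where
  "smooth_on S f \<longleftrightarrow>
     (\<forall>x\<in>S. \<exists>U g. open U \<and> x \<in> U \<and> (\<forall>k. Ck_on k g U) \<and> (\<forall>z\<in>U \<inter> S. g z = f z))"

definition strictly_convex_on :: "'a::real_vector set \<Rightarrow> ('a \<Rightarrow> real) \<Rightarrow> bool" where
  "strictly_convex_on S f \<longleftrightarrow> convex S \<and>
     (\<forall>x\<in>S. \<forall>y\<in>S. \<forall>s. x \<noteq> y \<longrightarrow> 0 < s \<longrightarrow> s < 1 \<longrightarrow>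
        f ((1 - s) *\<^sub>R x + s *\<^sub>R y) < (1 - s) * f x + s * f y)"

definition grad :: "(real^'m \<Rightarrow> real) \<Rightarrow> real^'m \<Rightarrow> real^'m" where
  "grad f x = (\<chi> i. frechet_derivative f (at x) (axis i 1))"

definition hess :: "(real^'m \<Rightarrow> real) \<Rightarrow> real^'m \<Rightarrow> real^'m^'m" where
  "hess f x = matrix (frechet_derivative (grad f) (at x))"

definition twice_differentiable_at :: "(real^'m \<Rightarrow> real) \<Rightarrow> real^'m \<Rightarrow> bool" where
  "twice_differentiable_at f x \<longleftrightarrow>
     (\<forall>\<^sub>F z in nhds x. f differentiable (at z)) \<and> grad f differentiable (at x)"


subsection \<open>Hermitian matrices\<close>

text \<open>The matrix \<open>A + \<surd>-1 B\<close>.\<close>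

definition complex_mat :: "real^'m^'m \<Rightarrow> real^'m^'m \<Rightarrow> complex^'m^'m" where
  "complex_mat A B = (\<chi> i j. complex_of_real (A $ i $ j) + \<i> * complex_of_real (B $ i $ j))"

definition hermitian_pos_def :: "complex^'m^'m \<Rightarrow> bool" where
  "hermitian_pos_def M \<longleftrightarrow>
     (\<forall>i j. M $ i $ j = cnj (M $ j $ i)) \<and>
     (\<forall>z. z \<noteq> 0 \<longrightarrow> 0 < Re (\<Sum>i\<in>UNIV. \<Sum>j\<in>UNIV. cnj (z $ i) * M $ i $ j * z $ j))"

text \<open>Only used for Hermitian matrices, whose determinant is real.\<close>

definition log_det :: "complex^'m^'m \<Rightarrow> real" where
  "log_det M = ln (Re (det M))"

definition skew_symmetric :: "real^'m^'m \<Rightarrow> bool" where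
  "skew_symmetric A \<longleftrightarrow> transpose A = - A"


subsection \<open>Labelled Delzant polytopes\<close>

text \<open>
  A compact toric symplectic manifold is represented, through Delzant's correspondence, by its
  labelled polytope in \<open>\<real>\<^sup>m\<close>.  The set \<open>\<Lambda>\<close> is the lattice of circle subgroups of the torus; under
  \<open>\<tt> \<cong> \<real>\<^sup>m\<close> it need not be the standard one.
\<close>

definition L :: "(nat \<Rightarrow> real^'m) \<Rightarrow> (nat \<Rightarrow> real) \<Rightarrow> nat \<Rightarrow> real^'m \<Rightarrow> real" where
  "L v lam j x = v j \<bullet> x + lam j"

definition labelled_polytope :: "nat \<Rightarrow> (nat \<Rightarrow> real^'m) \<Rightarrow> (nat \<Rightarrow> real) \<Rightarrow> (real^'m) set" where
  "labelled_polytope d v lam = {x. \<forall>j\<in>{1..d}. 0 \<le> L v lam j x}"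

definition lattice_basis :: "(real^'m) set \<Rightarrow> (real^'m) set \<Rightarrow> bool" where
  "lattice_basis \<Lambda> S \<longleftrightarrow>
     independent S \<and> span S = UNIV \<and>
     \<Lambda> = {\<Sum>w\<in>S. of_int (c w) *\<^sub>R w | c :: real^'m \<Rightarrow> int. True}"

text \<open>
  The vertex condition forces \<open>\<Lambda>\<close> to be a lattice of full rank, exactly \<open>m\<close> facets to meet at
  each vertex, the normals to be primitive, and distinct labels to cut out distinct facets.
\<close>

definition delzant ::
  "(real^'m) set \<Rightarrow> nat \<Rightarrow> (nat \<Rightarrow> real^'m) \<Rightarrow> (nat \<Rightarrow> real) \<Rightarrow> bool" where
  "delzant \<Lambda> d v lam \<longleftrightarrow>
     (let P = labelled_polytope d v lam in
        compact P \<and> interior P \<noteq> {} \<and>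
        (\<forall>j\<in>{1..d}. {x\<in>P. L v lam j x = 0} facet_of P) \<and>
        (\<forall>p. p extreme_point_of P \<longrightarrow>
           (let J = {j\<in>{1..d}. L v lam j p = 0} in
              inj_on v J \<and> lattice_basis \<Lambda> (v ` J))))"

text \<open>Normalization of the labels when the symplectic class is \<open>2\<pi>c\<^sub>1(M)\<close>.\<close>

definition fano_normalized :: "nat \<Rightarrow> (nat \<Rightarrow> real^'m) \<Rightarrow> (nat \<Rightarrow> real) \<Rightarrow> bool" where
  "fano_normalized d v lam \<longleftrightarrow> (\<forall>j\<in>{1..d}. L v lam j 0 = 1)"


subsection \<open>Symplectic potentials\<close>

text \<open>On the boundary of the polytope, \<open>0 * ln 0 = 0\<close> is the continuous extension.\<close>

definition guillemin ::
  "nat \<Rightarrow> (nat \<Rightarrow> real^'m) \<Rightarrow> (nat \<Rightarrow> real) \<Rightarrow> real^'m \<Rightarrow> real" where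
  "guillemin d v lam x = 1/2 * (\<Sum>j=1..d. L v lam j x * ln (L v lam j x))"

text \<open>
  The space \<open>S(P, L)\<close>; values outside \<open>P\<close> are irrelevant.  The face \<open>F = P\<close> gives the
  conditions on the interior of \<open>P\<close>.
\<close>

definition symplectic_potentials ::
  "nat \<Rightarrow> (nat \<Rightarrow> real^'m) \<Rightarrow> (nat \<Rightarrow> real) \<Rightarrow> (real^'m \<Rightarrow> real) set" where
  "symplectic_potentials d v lam =
     (let P = labelled_polytope d v lam in
        {u. continuous_on P u \<and>
            (\<forall>F. F face_of P \<longrightarrow>
               smooth_on (rel_interior F) u \<and> strictly_convex_on (rel_interior F) u) \<and>
            smooth_on P (\<lambda>x. u x - guillemin d v lam x)})"

definition smooth_path_of_potentials ::
  "nat \<Rightarrow> (nat \<Rightarrow> real^'m) \<Rightarrow> (nat \<Rightarrow> real) \<Rightarrow> real set \<Rightarrow> (real \<Rightarrow> real^'m \<Rightarrow> real) \<Rightarrow> bool" where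
  "smooth_path_of_potentials d v lam T u \<longleftrightarrow>
     (\<forall>t\<in>T. u t \<in> symplectic_potentials d v lam) \<and>
     smooth_on (T \<times> labelled_polytope d v lam) (\<lambda>(t, x). u t x - guillemin d v lam x)"

text \<open>
  \<open>\<phi>(y) = \<langle>y, x\<rangle> - u(x)\<close> at the point \<open>x\<close> of the interior of \<open>P\<close> with \<open>y = \<nabla>u(x)\<close>.
\<close>

definition legendre :: "(real^'m) set \<Rightarrow> (real^'m \<Rightarrow> real) \<Rightarrow> real^'m \<Rightarrow> real" where
  "legendre P u y = (let x = the_inv_into (interior P) (grad u) y in y \<bullet> x - u x)"

lemma legendre_grad:
  assumes "inj_on (grad u) (interior P)" and "x \<in> interior P"
  shows "legendre P u (grad u x) + u x = grad u x \<bullet> x"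
  using assms by (simp add: legendre_def the_inv_into_f_f)


subsection \<open>Solutions of the flow\<close>

definition flow_solution ::
  "nat \<Rightarrow> (nat \<Rightarrow> real^'m) \<Rightarrow> (nat \<Rightarrow> real) \<Rightarrow> real^'m^'m \<Rightarrow> real^'m^'m \<Rightarrow> real set \<Rightarrow>
   (real \<Rightarrow> real^'m \<Rightarrow> real) \<Rightarrow> (real \<Rightarrow> real^'m^'m) \<Rightarrow> (real \<Rightarrow> real^'m^'m) \<Rightarrow> bool" where
  "flow_solution d v lam A\<^sub>0 B\<^sub>0 T u A B \<longleftrightarrow>
     smooth_path_of_potentials d v lam T u \<and>
     (\<forall>t\<in>T. A t = exp (- 2 * t) *\<^sub>R A\<^sub>0 \<and> B t = exp (- 2 * t) *\<^sub>R B\<^sub>0) \<and>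
     (\<forall>t\<in>T. \<forall>x\<in>interior (labelled_polytope d v lam).
        hermitian_pos_def (complex_mat (hess (u t) x) (exp (- 2 * t) *\<^sub>R B\<^sub>0)) \<and>
        ((\<lambda>s. u s x) has_real_derivative
           log_det (complex_mat (hess (u t) x) (exp (- 2 * t) *\<^sub>R B\<^sub>0))
           - 2 * (- u t x + (\<Sum>j\<in>UNIV. x $ j * grad (u t) x $ j))) (at t within T))"

end

theory Submission
  imports Defs
begin

text \<open>
  Fix \<open>y\<close> and put \<open>f s x = \<langle>y, x\<rangle> - u\<^sub>s(x)\<close>.  The Legendre transform is an upper envelope:
  \<open>\<phi>\<^sub>s(y) = max f s\<close>, the maximum over the polytope \<open>P\<close>, attained at the single point \<open>X\<^sub>s\<close>
  with \<open>\<nabla>u\<^sub>s(X\<^sub>s) = y\<close>.  Everything follows from this description.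

  The gradient \<open>\<nabla>u\<^sub>s\<close> maps the interior of \<open>P\<close> bijectively onto \<open>\<real>\<^sup>m\<close>.  A continuous function on the
  compact \<open>P\<close> has a maximum.  It cannot lie on the boundary: there some label \<open>L\<^sub>j\<close> vanishes, and the
  term \<open>1/2 L\<^sub>j ln L\<^sub>j\<close> of \<open>u\<close> makes \<open>f s\<close> grow with infinite slope along the segment towards the
  centre \<open>0\<close>, where the Fano normalization gives \<open>L\<^sub>j = 1\<close> (\<open>boundary_point_not_maximal\<close>).  So it is a
  critical point, and strict convexity makes critical points unique (\<open>grad_bij_maximizer\<close>).

  The inverse of \<open>\<nabla>u\<^sub>t\<close> is \<open>\<nabla>\<phi>\<^sub>t\<close>; hence \<open>Hess \<phi>\<^sub>t(y)\<close> is the inverse of \<open>Hess u\<^sub>t(X\<^sub>t)\<close>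
  (\<open>legendre_second_order\<close>).  The Hessian of \<open>u\<^sub>t\<close> is invertible because \<open>Hess u\<^sub>t + \<i> B\<close> is positive
  definite and the skew matrix \<open>B\<close> contributes nothing to the real part on real vectors.

  In time, \<open>\<partial>\<^sub>t \<phi>\<^sub>t(y) = - (\<partial>\<^sub>t u\<^sub>t)(X\<^sub>t)\<close> by the envelope principle (\<open>envelope_derivative\<close>): comparing
  \<open>f s\<close> and \<open>f t\<close> at the two maximizers squeezes the difference quotient of the maximum,
  because \<open>X\<^sub>s\<close> is continuous at \<open>t\<close> by compactness (\<open>maximizer_tendsto\<close>).  The
  Guillemin potential cancels in the differences \<open>u\<^sub>s(x) - u\<^sub>t(x)\<close>, so the smoothness of \<open>u - guillemin\<close> on \<open>T \<times> P\<close> supplies the required uniformity.  Inserting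
  \<open>x = X\<^sub>t\<close>, \<open>\<nabla>u\<^sub>t(x) = y\<close> into the equation of \<open>u\<close> turns \<open>2 (- u + \<langle>x, \<nabla>u\<rangle>)\<close> into \<open>2 \<phi>\<close>, and the
  sign in front of \<open>log det\<close> is absorbed by inverting the matrix.
\<close>

section \<open>Gradients and Hessians\<close>

lemma has_derivative_grad:
  assumes "f differentiable (at x)"
  shows "(f has_derivative (\<lambda>h. grad f x \<bullet> h)) (at x)"
proof -
  let ?F = "frechet_derivative f (at x)"
  have F: "(f has_derivative ?F) (at x)"
    using assms frechet_derivative_works by blast
  then have lin: "linear ?F"
    by (simp add: has_derivative_bounded_linear bounded_linear.linear)
  have "?F h = grad f x \<bullet> h" for h
  proof -
    have "?F h = ?F (\<Sum>i\<in>UNIV. h $ i *\<^sub>R axis i 1)"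
      using basis_expansion[of h] by (simp add: scalar_mult_eq_scaleR)
    also have "\<dots> = (\<Sum>i\<in>UNIV. h $ i * ?F (axis i 1))"
      by (simp add: linear_sum[OF lin] linear_cmul[OF lin])
    also have "\<dots> = grad f x \<bullet> h"
      by (simp add: grad_def inner_vec_def mult.commute)
    finally show ?thesis .
  qed
  then have "?F = (\<lambda>h. grad f x \<bullet> h)" by (rule ext)
  with F show ?thesis by simp
qed

lemma grad_unique:
  assumes "(f has_derivative (\<lambda>h. a \<bullet> h)) (at x)"
  shows "grad f x = a"
  by (simp add: grad_def vec_eq_iff inner_axis flip: frechet_derivative_at[OF assms])

lemma hess_eqI:
  assumes "(grad f has_derivative (\<lambda>h. A *v h)) (at x)"
  shows "hess f x = A"
  unfolding hess_def using frechet_derivative_at[OF assms] by (metis matrix_of_matrix_vector_mul)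

lemma has_derivative_hess:
  assumes "grad f differentiable (at x)"
  shows "(grad f has_derivative (\<lambda>h. hess f x *v h)) (at x)"
proof -
  let ?F = "frechet_derivative (grad f) (at x)"
  have F: "(grad f has_derivative ?F) (at x)"
    using assms frechet_derivative_works by blast
  then have "linear ?F"
    by (simp add: has_derivative_bounded_linear bounded_linear.linear)
  then have "?F = (\<lambda>h. hess f x *v h)"
    by (simp add: hess_def matrix_works linear_matrix_vector_mul_eq)
  with F show ?thesis by simp
qed

text \<open>
  On an open set the local smooth extensions agree with the function near each point, so its
  derivatives are theirs.
\<close>

lemma smooth_on_imp_twice_differentiable:
  fixes f :: "real^'m \<Rightarrow> real"
  assumes "open S" "smooth_on S f" "x \<in> S"
  shows "f differentiable (at x)" "grad f differentiable (at x)"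
proof -
  obtain U g where U: "open U" "x \<in> U" and g: "\<And>k. Ck_on k g U"
    and eq: "\<And>z. z \<in> U \<inter> S \<Longrightarrow> g z = f z"
    using assms unfolding smooth_on_def by metis
  let ?V = "U \<inter> S"
  have V: "open ?V" "x \<in> ?V" using U assms by auto
  have g1: "g differentiable (at z)" if "z \<in> ?V" for z
    using g[of 1] that by auto
  have fg: "(f has_derivative (\<lambda>h. grad g z \<bullet> h)) (at z)" if z: "z \<in> ?V" for z
    using has_derivative_transform_within_open[OF has_derivative_grad[OF g1[OF z]] V(1) z eq] .
  show "f differentiable (at x)"
    using fg[OF V(2)] differentiable_def by blast
  have gradeq: "grad f z = grad g z" if "z \<in> ?V" for z
    using grad_unique[OF fg[OF that]] .
  have "(\<lambda>z. frechet_derivative g (at z) b) differentiable (at x)" if "b \<in> Basis" for b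
    using g[of "Suc (Suc 0)"] that U by auto
  then have "(\<lambda>z. frechet_derivative g (at z) (axis i 1)) differentiable (at x)" for i
    by (simp add: axis_in_Basis_iff)
  then have "(\<lambda>z. grad g z \<bullet> b) differentiable (at x)" if "b \<in> Basis" for b
    using that by (auto simp: Basis_vec_def grad_def inner_axis)
  then have "grad g differentiable (at x)"
    using differentiable_componentwise_within[of "grad g" x UNIV] by auto
  then obtain D where "(grad g has_derivative D) (at x)"
    by (auto simp: differentiable_def)
  then have "(grad f has_derivative D) (at x)"
    by (rule has_derivative_transform_within_open[OF _ V]) (simp add: gradeq)
  then show "grad f differentiable (at x)"
    by (auto simp: differentiable_def)
qed

lemma smooth_on_imp_continuous_on:
  assumes "smooth_on S f"
  shows "continuous_on S f"
  unfolding continuous_on_eq_continuous_within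
proof
  fix x assume x: "x \<in> S"
  obtain U g where U: "open U" "x \<in> U" and g: "\<And>k. Ck_on k g U"
    and eq: "\<And>z. z \<in> U \<inter> S \<Longrightarrow> g z = f z"
    using assms x unfolding smooth_on_def by metis
  have "isCont g x"
    using g[of 0] U continuous_on_eq_continuous_at by auto
  then have lim: "(g \<longlongrightarrow> g x) (at x within S)"
    by (simp add: continuous_at_imp_continuous_at_within flip: continuous_within)
  have "\<forall>\<^sub>F z in at x within S. g z = f z"
    unfolding eventually_at_topological using U eq by blast
  then have "(f \<longlongrightarrow> g x) (at x within S)"
    using lim by (metis (mono_tags, lifting) tendsto_cong)
  then show "continuous (at x within S) f"
    using eq[of x] U x by (simp add: continuous_within)
qed

text \<open>
  Difference quotients along the segment from \<open>x\<close> are bounded by the slope of the chord, which gives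
  the weak inequality; applied to the midpoint, which lies strictly below the chord, it becomes strict.
\<close>

lemma strictly_convex_on_above_tangent:
  fixes u :: "real^'m \<Rightarrow> real"
  assumes sc: "strictly_convex_on S u" and "open S" and x: "x \<in> S" and z: "z \<in> S" "z \<noteq> x"
    and u: "u differentiable (at x)"
  shows "u x + grad u x \<bullet> (z - x) < u z"
proof -
  have cS: "convex S" using sc by (simp add: strictly_convex_on_def)
  have sc': "u ((1 - s) *\<^sub>R x + s *\<^sub>R w) < (1 - s) * u x + s * u w"
    if "w \<in> S" "w \<noteq> x" "0 < s" "s < 1" for w s
    using sc x that unfolding strictly_convex_on_def by simp
  have weak: "u x + grad u x \<bullet> (w - x) \<le> u w" if w: "w \<in> S" "w \<noteq> x" for w
  proof -
    define h where "h s = u (x + s *\<^sub>R (w - x))" for s :: real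
    have dl: "((\<lambda>s. x + s *\<^sub>R (w - x)) has_derivative (\<lambda>k. k *\<^sub>R (w - x))) (at 0)"
      by (auto intro!: derivative_eq_intros)
    have "(h has_derivative (\<lambda>k. grad u x \<bullet> (k *\<^sub>R (w - x)))) (at 0)"
      unfolding h_def
      by (rule has_derivative_compose[OF dl, of u "\<lambda>h. grad u x \<bullet> h"])
        (use has_derivative_grad[OF u] in simp)
    then have "(h has_real_derivative grad u x \<bullet> (w - x)) (at 0)"
      by (simp add: has_field_derivative_def mult_commute_abs)
    then have "(h has_real_derivative grad u x \<bullet> (w - x)) (at 0 within {0<..})"
      by (rule has_field_derivative_at_within)
    then have "((\<lambda>s. (h s - h 0) / (s - 0)) \<longlongrightarrow> grad u x \<bullet> (w - x)) (at_right 0)"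
      by (simp add: has_field_derivative_iff)
    moreover have "\<forall>\<^sub>F s in at_right (0::real). (h s - h 0) / (s - 0) \<le> u w - u x"
      unfolding eventually_at_right_field
    proof (intro exI conjI allI impI)
      show "(0::real) < 1" by simp
      fix s :: real assume s: "0 < s" "s < 1"
      have "h s = u ((1 - s) *\<^sub>R x + s *\<^sub>R w)"
        unfolding h_def by (simp add: algebra_simps)
      also have "\<dots> < (1 - s) * u x + s * u w"
        by (rule sc') (use w s in auto)
      finally have "h s - h 0 \<le> s * (u w - u x)"
        by (simp add: h_def algebra_simps)
      then show "(h s - h 0) / (s - 0) \<le> u w - u x"
        using s by (simp add: field_simps)
    qed
    ultimately have "grad u x \<bullet> (w - x) \<le> u w - u x"
      by (intro tendsto_upperbound[of _ _ "at_right (0::real)"]) auto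
    then show ?thesis by simp
  qed
  define m where "m = (1 - 1/2) *\<^sub>R x + (1/2) *\<^sub>R z"
  have "m \<in> S"
    unfolding m_def using cS x z by (intro convexD) auto
  have mx: "m - x = (1/2) *\<^sub>R (z - x)"
    by (simp add: m_def vec_eq_iff field_simps)
  then have "m \<noteq> x" using z by auto
  have "u m < (1 - 1/2) * u x + 1/2 * u z"
    unfolding m_def by (rule sc') (use z in auto)
  with weak[OF \<open>m \<in> S\<close> \<open>m \<noteq> x\<close>] mx show ?thesis by simp
qed

section \<open>Hermitian matrices\<close>

text \<open>
  On a real vector the form of \<open>B\<close> enters with the factor \<open>\<i>\<close> and drops out of the real part.
\<close>

lemma hermitian_pos_def_complex_matD:
  assumes "hermitian_pos_def (complex_mat H B)" "h \<noteq> 0"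
  shows "0 < h \<bullet> (H *v h)"
proof -
  define z :: "complex^'a" where "z = (\<chi> i. complex_of_real (h $ i))"
  have "z \<noteq> 0" using assms(2) by (auto simp: z_def vec_eq_iff)
  then have "0 < Re (\<Sum>i\<in>UNIV. \<Sum>j\<in>UNIV. cnj (z $ i) * complex_mat H B $ i $ j * z $ j)"
    using assms(1) unfolding hermitian_pos_def_def by blast
  also have "\<dots> = (\<Sum>i\<in>UNIV. \<Sum>j\<in>UNIV. h $ i * H $ i $ j * h $ j)"
    by (simp add: z_def complex_mat_def algebra_simps)
  also have "\<dots> = h \<bullet> (H *v h)"
    by (simp add: inner_vec_def matrix_vector_mult_def sum_distrib_left mult.assoc)
  finally show ?thesis .
qed

lemma hermitian_pos_def_invertible:
  assumes "hermitian_pos_def M"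
  shows "invertible M"
proof -
  have "M *v z \<noteq> 0" if "z \<noteq> 0" for z
  proof
    assume 0: "M *v z = 0"
    have "(\<Sum>i\<in>UNIV. \<Sum>j\<in>UNIV. cnj (z $ i) * M $ i $ j * z $ j) = (\<Sum>i\<in>UNIV. cnj (z $ i) * (M *v z) $ i)"
      by (simp add: matrix_vector_mult_def sum_distrib_left mult.assoc)
    also have "\<dots> = 0" by (simp add: 0)
    finally have "Re (\<Sum>i\<in>UNIV. \<Sum>j\<in>UNIV. cnj (z $ i) * M $ i $ j * z $ j) = 0" by simp
    moreover have "0 < Re (\<Sum>i\<in>UNIV. \<Sum>j\<in>UNIV. cnj (z $ i) * M $ i $ j * z $ j)"
      using assms that unfolding hermitian_pos_def_def by blast
    ultimately show False by linarith
  qed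
  then show ?thesis
    unfolding invertible_left_inverse matrix_left_invertible_ker by blast
qed

text \<open>
  Conjugating the entries transposes the matrix, which leaves the determinant unchanged.
\<close>

lemma det_hermitian_real:
  fixes M :: "complex^'n^'n"
  assumes "\<And>i j. M $ i $ j = cnj (M $ j $ i)"
  shows "Im (det M) = 0"
proof -
  have "transpose M = (\<chi> i j. cnj (M $ i $ j))"
    unfolding vec_eq_iff transpose_def vec_lambda_beta by (intro allI assms)
  moreover have "cnj (det M) = det (\<chi> i j. cnj (M $ i $ j))"
    by (simp add: det_def)
  ultimately have "cnj (det M) = det (transpose M)" by simp
  then have "cnj (det M) = det M" by (simp add: det_transpose)
  then show ?thesis by (simp add: complex_eq_iff)
qed

lemma matrix_matrix_inv:
  assumes "invertible M"
  shows "M ** matrix_inv M = mat 1" "matrix_inv M ** M = mat 1"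
  using someI_ex[OF assms[unfolded invertible_def]] by (simp_all add: matrix_inv_def)

lemma log_det_matrix_inv:
  assumes "hermitian_pos_def M"
  shows "log_det (matrix_inv M) = - log_det M"
proof -
  have "M ** matrix_inv M = mat 1"
    using hermitian_pos_def_invertible[OF assms] by (rule matrix_matrix_inv)
  then have "det M * det (matrix_inv M) = 1"
    by (metis det_I det_mul)
  then have inv: "det (matrix_inv M) = inverse (det M)"
    by (metis inverse_unique)
  have "Im (det M) = 0"
    using assms unfolding hermitian_pos_def_def by (blast intro: det_hermitian_real)
  then have "det M = complex_of_real (Re (det M))"
    by (simp add: complex_eq_iff)
  then have "Re (det (matrix_inv M)) = inverse (Re (det M))"
    unfolding inv by (metis Re_complex_of_real of_real_inverse)
  then show ?thesis by (simp add: log_det_def ln_inverse)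
qed

lemma matrix_inv_matrix_inv:
  assumes "invertible M"
  shows "invertible (matrix_inv M)" "matrix_inv (matrix_inv M) = M"
proof -
  note inv = matrix_matrix_inv[OF assms]
  show i: "invertible (matrix_inv M)"
    using inv unfolding invertible_def by blast
  have "matrix_inv (matrix_inv M) = (M ** matrix_inv M) ** matrix_inv (matrix_inv M)"
    by (simp add: inv)
  also have "\<dots> = M"
    by (simp add: matrix_matrix_inv[OF i] flip: matrix_mul_assoc)
  finally show "matrix_inv (matrix_inv M) = M" .
qed

lemma hermitian_pos_def_complex_mat_invertible:
  assumes "hermitian_pos_def (complex_mat H B)"
  shows "invertible H"
proof -
  have "h = 0" if "H *v h = 0" for h
    using hermitian_pos_def_complex_matD[OF assms, of h] that by force
  then show ?thesis
    unfolding invertible_left_inverse matrix_left_invertible_ker by blast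
qed

section \<open>Symplectic potentials near the boundary of the polytope\<close>

lemma convex_labelled_polytope: "convex (labelled_polytope d v lam)"
proof -
  have "{x. 0 \<le> L v lam j x} = {x. v j \<bullet> x \<ge> - lam j}" for j
    by (auto simp: L_def)
  then have "labelled_polytope d v lam = (\<Inter>j\<in>{1..d}. {x. v j \<bullet> x \<ge> - lam j})"
    by (auto simp: labelled_polytope_def)
  then show ?thesis by (simp add: convex_INT convex_halfspace_ge)
qed

lemma interior_labelled_polytopeI:
  assumes "\<And>j. j \<in> {1..d} \<Longrightarrow> 0 < L v lam j x"
  shows "x \<in> interior (labelled_polytope d v lam)"
proof (rule interiorI)
  have "{x. 0 < L v lam j x} = {x. v j \<bullet> x > - lam j}" for j
    by (auto simp: L_def)
  then have eq: "(\<Inter>j\<in>{1..d}. {x. v j \<bullet> x > - lam j}) = {x. \<forall>j\<in>{1..d}. 0 < L v lam j x}"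
    by auto
  have "open (\<Inter>j\<in>{1..d}. {x. v j \<bullet> x > - lam j})"
    by (intro open_INT) (auto simp: open_halfspace_gt)
  then show "open {x. \<forall>j\<in>{1..d}. 0 < L v lam j x}" by (simp only: eq)
qed (use assms in \<open>auto simp: labelled_polytope_def less_imp_le\<close>)

lemma zero_in_interior_labelled_polytope:
  "fano_normalized d v lam \<Longrightarrow> 0 \<in> interior (labelled_polytope d v lam)"
  by (rule interior_labelled_polytopeI) (simp add: fano_normalized_def)

text \<open>
  This is convexity of \<open>a ln a\<close> between \<open>a\<close> and \<open>1\<close>, where the function vanishes.  It holds with
  \<open>a = 0\<close> because \<open>0 * ln 0 = 0\<close> is the continuous extension.
\<close>

lemma x_ln_x_towards_one:
  fixes a s :: real
  assumes "0 \<le> a" "0 < s" "s < 1"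
  shows "((1 - s) * a + s) * ln ((1 - s) * a + s) \<le> (1 - s) * (a * ln a)"
proof (cases "a = 0")
  case True
  then show ?thesis using assms by (simp add: mult_nonneg_nonpos)
next
  case False
  define m where "m = (1 - s) * a + s"
  have "0 \<le> (1 - s) * a" using assms by simp
  then have m: "0 < m" unfolding m_def using assms by linarith
  have tangent: "b * ln m \<le> b * ln b + (m - b)" if "0 < b" for b
  proof -
    have "ln (m / b) \<le> m / b - 1" using m that by (intro ln_le_minus_one) simp
    then have "b * ln (m / b) \<le> b * (m / b - 1)"
      using that by (intro mult_left_mono) auto
    also have "\<dots> = m - b" using that by (simp add: field_simps)
    finally show ?thesis using m that by (simp add: ln_div algebra_simps)
  qed
  have "(1 - s) * (a * ln m) \<le> (1 - s) * (a * ln a + (m - a))"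
    using tangent[of a] assms False by (intro mult_left_mono) auto
  moreover have "s * (1 * ln m) \<le> s * (1 * ln 1 + (m - 1))"
    using tangent[of 1] assms by (intro mult_left_mono) auto
  moreover have "(1 - s) * (m - a) + s * (m - 1) = 0"
    by (simp add: m_def algebra_simps)
  ultimately have "m * ln m \<le> (1 - s) * (a * ln a)"
    by (simp add: m_def algebra_simps)
  then show ?thesis by (simp add: m_def)
qed

text \<open>
  Moving from \<open>p\<close> towards \<open>0\<close> replaces each label value \<open>a\<close> by \<open>(1 - s) a + s\<close>, since
  all labels are \<open>1\<close> at \<open>0\<close>.  Convexity bounds all terms; the label vanishing at \<open>p\<close> contributes exactly \<open>s ln s / 2\<close>, which beats every
  multiple of \<open>s\<close> as \<open>s\<close> tends to \<open>0\<close>.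
\<close>

lemma guillemin_towards_centre:
  assumes "fano_normalized d v lam" and p: "p \<in> labelled_polytope d v lam"
    and j: "j \<in> {1..d}" "L v lam j p = 0" and s: "0 < s" "s < 1"
  shows "guillemin d v lam ((1 - s) *\<^sub>R p) \<le> (1 - s) * guillemin d v lam p + s * ln s / 2"
proof -
  have L1: "L v lam i ((1 - s) *\<^sub>R p) = (1 - s) * L v lam i p + s" if "i \<in> {1..d}" for i
    using assms(1) that by (simp add: fano_normalized_def L_def algebra_simps)
  let ?e = "\<lambda>i. (1 - s) * (L v lam i p * ln (L v lam i p))"
  have "(\<Sum>i=1..d. L v lam i ((1 - s) *\<^sub>R p) * ln (L v lam i ((1 - s) *\<^sub>R p)))
    \<le> (\<Sum>i=1..d. ?e i + (if i = j then s * ln s else 0))"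
  proof (rule sum_mono)
    fix i assume i: "i \<in> {1..d}"
    then have "0 \<le> L v lam i p" using p by (simp add: labelled_polytope_def)
    from x_ln_x_towards_one[OF this s] L1[OF i] j
    show "L v lam i ((1 - s) *\<^sub>R p) * ln (L v lam i ((1 - s) *\<^sub>R p))
      \<le> ?e i + (if i = j then s * ln s else 0)" by auto
  qed
  also have "\<dots> = (1 - s) * (\<Sum>i=1..d. L v lam i p * ln (L v lam i p)) + s * ln s"
    using j by (simp add: sum.distrib sum_distrib_left)
  finally show ?thesis by (simp add: guillemin_def)
qed

text \<open>
  A point slightly closer to \<open>0\<close> does better: the smooth part of \<open>u\<close> and the linear function change
  by \<open>O(s)\<close>, whereas the Guillemin potential drops by at least \<open>- s ln s / 2\<close> up to \<open>O(s)\<close>.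
\<close>

lemma boundary_point_not_maximal:
  assumes fano: "fano_normalized d v lam" and u: "u \<in> symplectic_potentials d v lam"
    and p: "p \<in> labelled_polytope d v lam" "p \<notin> interior (labelled_polytope d v lam)"
  shows "\<exists>z\<in>labelled_polytope d v lam. y \<bullet> p - u p < y \<bullet> z - u z"
proof -
  let ?P = "labelled_polytope d v lam" and ?G = "guillemin d v lam"
  obtain j where j: "j \<in> {1..d}" "L v lam j p = 0"
    using interior_labelled_polytopeI[of d v lam p] p by (force simp: labelled_polytope_def)
  have "smooth_on ?P (\<lambda>x. u x - ?G x)"
    using u by (simp add: symplectic_potentials_def Let_def)
  then obtain U g where U: "open U" "p \<in> U" and g: "\<And>k. Ck_on k g U"
    and eq: "\<And>z. z \<in> U \<inter> ?P \<Longrightarrow> g z = u z - ?G z"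
    using p(1) unfolding smooth_on_def by metis
  have "g differentiable (at p)" using g[of 1] U by auto
  define h where "h s = g ((1 - s) *\<^sub>R p)" for s :: real
  have "((\<lambda>s. (1 - s) *\<^sub>R p) has_derivative (\<lambda>k. - k *\<^sub>R p)) (at (0::real))"
    by (auto intro!: derivative_eq_intros)
  then have "(h has_derivative (\<lambda>k. grad g p \<bullet> (- k *\<^sub>R p))) (at 0)"
    unfolding h_def
    by (rule has_derivative_compose[where g = g and g' = "\<lambda>h. grad g p \<bullet> h"])
      (use has_derivative_grad[OF \<open>g differentiable (at p)\<close>] in simp)
  then have "(h has_real_derivative - (grad g p \<bullet> p)) (at 0)"
    unfolding has_field_derivative_def by (rule has_derivative_eq_rhs) (simp add: fun_eq_iff)
  then have "(h has_real_derivative - (grad g p \<bullet> p)) (at 0 within {0<..})"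
    by (rule has_field_derivative_at_within)
  then have lim: "((\<lambda>s. (h s - h 0) / (s - 0)) \<longlongrightarrow> - (grad g p \<bullet> p)) (at_right 0)"
    by (simp add: has_field_derivative_iff)
  \<comment> \<open>any number above the slope of the smooth part of \<open>u\<close> in the direction \<open>- p\<close> works as \<open>K\<close>\<close>
  define K where "K = - (grad g p \<bullet> p) + 1"
  have "\<forall>\<^sub>F s in at_right 0. (h s - h 0) / (s - 0) < K"
    using order_tendstoD(2)[OF lim] by (simp add: K_def)
  \<comment> \<open>the bound makes \<open>s ln s / 2\<close> outweigh the sum of all terms that are linear in \<open>s\<close>\<close>
  moreover have "\<forall>\<^sub>F s in at_right 0. ln s < 2 * (?G p - K - y \<bullet> p)"
    using ln_at_0 by (simp add: filterlim_at_bot_dense)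
  moreover have "\<forall>\<^sub>F s in at_right (0::real). 0 < s \<and> s < 1"
    unfolding eventually_at_right_field by (intro exI[of _ 1]) auto
  moreover have "\<forall>\<^sub>F s in at_right (0::real). (1 - s) *\<^sub>R p \<in> U"
  proof -
    have "((\<lambda>s. (1 - s) *\<^sub>R p) \<longlongrightarrow> (1 - 0) *\<^sub>R p) (at_right (0::real))"
      by (intro tendsto_intros)
    then show ?thesis using topological_tendstoD U by fastforce
  qed
  ultimately have "\<forall>\<^sub>F s in at_right (0::real). (h s - h 0) / (s - 0) < K \<and>
      ln s < 2 * (?G p - K - y \<bullet> p) \<and> 0 < s \<and> s < 1 \<and> (1 - s) *\<^sub>R p \<in> U"
    by eventually_elim auto
  then obtain s where hs: "(h s - h 0) / (s - 0) < K" and ln: "ln s < 2 * (?G p - K - y \<bullet> p)"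
    and s: "0 < s" "s < 1" and zU: "(1 - s) *\<^sub>R p \<in> U"
    using eventually_happens'[of "at_right (0::real)"] by fastforce
  let ?z = "(1 - s) *\<^sub>R p"
  have "0 \<in> ?P"
    using zero_in_interior_labelled_polytope[OF fano] interior_subset by blast
  from convexD[OF convex_labelled_polytope p(1) this, of "1 - s" s]
  have zP: "?z \<in> ?P" using s by simp
  have "g ?z - g p < K * s" using hs s by (simp add: h_def field_simps)
  moreover have "g ?z = u ?z - ?G ?z" "g p = u p - ?G p"
    using eq zU zP U p by auto
  moreover have "?G ?z \<le> (1 - s) * ?G p + s * ln s / 2"
    using guillemin_towards_centre[OF fano p(1) j s] .
  moreover have "s * ln s < s * (2 * (?G p - K - y \<bullet> p))"
    using ln s by (intro mult_strict_left_mono)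
  ultimately have "y \<bullet> p - u p < y \<bullet> ?z - u ?z"
    by (simp add: algebra_simps)
  with zP show ?thesis by blast
qed

text \<open>
  The polytope is a face of itself, and its relative interior is its interior.
\<close>

lemma symplectic_potential_interior:
  assumes "u \<in> symplectic_potentials d v lam" "interior (labelled_polytope d v lam) \<noteq> {}"
  shows "smooth_on (interior (labelled_polytope d v lam)) u"
    and "strictly_convex_on (interior (labelled_polytope d v lam)) u"
proof -
  have "labelled_polytope d v lam face_of labelled_polytope d v lam"
    by (simp add: face_of_refl convex_labelled_polytope)
  then show "smooth_on (interior (labelled_polytope d v lam)) u"
    and "strictly_convex_on (interior (labelled_polytope d v lam)) u"
    using assms rel_interior_nonempty_interior[OF assms(2)]
    by (auto simp: symplectic_potentials_def Let_def)
qed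

text \<open>
  The maximum of \<open>\<langle>y, z\<rangle> - u(z)\<close> exists by compactness and is interior by
  \<open>boundary_point_not_maximal\<close>, so it is a solution of \<open>\<nabla>u = y\<close>; two solutions would contradict the
  strict tangent inequality.
\<close>

lemma grad_bij_maximizer:
  assumes cpt: "compact (labelled_polytope d v lam)" and fano: "fano_normalized d v lam"
    and u: "u \<in> symplectic_potentials d v lam"
  shows "bij_betw (grad u) (interior (labelled_polytope d v lam)) UNIV"
    and "\<lbrakk>x \<in> interior (labelled_polytope d v lam); z \<in> labelled_polytope d v lam; z \<noteq> x\<rbrakk>
      \<Longrightarrow> grad u x \<bullet> z - u z < grad u x \<bullet> x - u x"
proof -
  let ?P = "labelled_polytope d v lam"
  have 0: "0 \<in> interior ?P" by (rule zero_in_interior_labelled_polytope[OF fano])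
  then have ne: "interior ?P \<noteq> {}" by blast
  note int = symplectic_potential_interior[OF u ne]
  note diff = smooth_on_imp_twice_differentiable(1)[OF open_interior int(1)]
  have tangent: "grad u x \<bullet> z - u z < grad u x \<bullet> x - u x"
    if "x \<in> interior ?P" "z \<in> interior ?P" "z \<noteq> x" for x z
    using strictly_convex_on_above_tangent[OF int(2) open_interior that diff[OF that(1)]]
    by (simp add: inner_diff_right)
  have inj: "inj_on (grad u) (interior ?P)"
  proof (rule inj_onI, rule ccontr)
    fix x z assume "x \<in> interior ?P" "z \<in> interior ?P" "grad u x = grad u z" "x \<noteq> z"
    then show False using tangent[of x z] tangent[of z x] by force
  qed
  have attain: "\<exists>x\<in>interior ?P. grad u x = y \<and> (\<forall>z\<in>?P. y \<bullet> z - u z \<le> y \<bullet> x - u x)" for y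
  proof -
    have "continuous_on ?P u" using u by (simp add: symplectic_potentials_def Let_def)
    then have "continuous_on ?P (\<lambda>z. y \<bullet> z - u z)" by (intro continuous_intros)
    moreover have "?P \<noteq> {}" using 0 interior_subset by blast
    ultimately have "\<exists>x\<in>?P. \<forall>z\<in>?P. y \<bullet> z - u z \<le> y \<bullet> x - u x"
      by (intro continuous_attains_sup cpt)
    then obtain x where x: "x \<in> ?P" "\<And>z. z \<in> ?P \<Longrightarrow> y \<bullet> z - u z \<le> y \<bullet> x - u x"
      by blast
    have xi: "x \<in> interior ?P"
      using boundary_point_not_maximal[OF fano u x(1), of y] x(2) by (meson not_less)
    have "((\<lambda>z. y \<bullet> z - u z) has_derivative (\<lambda>h. y \<bullet> h - grad u x \<bullet> h)) (at x)"
      by (intro derivative_intros has_derivative_grad diff xi)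
    then have "(\<lambda>h. y \<bullet> h - grad u x \<bullet> h) = (\<lambda>h. 0)"
      by (rule differential_zero_maxmin[OF xi open_interior]) (use x(2) interior_subset in blast)
    then have "(y - grad u x) \<bullet> (y - grad u x) = 0"
      by (metis inner_diff_left)
    then have "grad u x = y" by simp
    with xi x(2) show ?thesis by blast
  qed
  have "y \<in> grad u ` interior ?P" for y
    using attain[of y] by blast
  then show "bij_betw (grad u) (interior ?P) UNIV"
    using inj by (auto simp: bij_betw_def)
  show "grad u x \<bullet> z - u z < grad u x \<bullet> x - u x"
    if x: "x \<in> interior ?P" and z: "z \<in> ?P" "z \<noteq> x"
  proof (cases "z \<in> interior ?P")
    case True
    then show ?thesis using tangent x z by blast
  next
    case False
    obtain w where w: "w \<in> interior ?P" "grad u w = grad u x"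
      "\<And>z. z \<in> ?P \<Longrightarrow> grad u x \<bullet> z - u z \<le> grad u x \<bullet> w - u w"
      using attain[of "grad u x"] by blast
    have "w = x" using inj w(1,2) x by (meson inj_onD)
    obtain z' where "z' \<in> ?P" "grad u x \<bullet> z - u z < grad u x \<bullet> z' - u z'"
      using boundary_point_not_maximal[OF fano u z(1) False] by blast
    with w(3)[of z'] \<open>w = x\<close> show ?thesis by simp
  qed
qed

section \<open>Legendre transforms\<close>

text \<open>
  The inverse \<open>X\<close> of \<open>\<nabla>u\<close> is differentiable by the inverse function theorem.  In the derivative of
  \<open>\<langle>y, X(y)\<rangle> - u(X(y))\<close> the two terms with the derivative of \<open>X\<close> cancel, because \<open>\<nabla>u(X(y)) = y\<close>,
  and \<open>\<nabla>\<phi> = X\<close> remains.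
\<close>

lemma legendre_second_order:
  fixes u :: "real^'m \<Rightarrow> real"
  assumes bij: "bij_betw (grad u) (interior P) UNIV"
    and diff: "\<And>x. x \<in> interior P \<Longrightarrow> u differentiable (at x)"
    and diff2: "\<And>x. x \<in> interior P \<Longrightarrow> grad u differentiable (at x)"
    and inv: "\<And>x. x \<in> interior P \<Longrightarrow> invertible (hess u x)"
  defines "X \<equiv> the_inv_into (interior P) (grad u)"
  shows "twice_differentiable_at (legendre P u) y"
    and "hess (legendre P u) y = matrix_inv (hess u (X y))"
proof -
  have Xin: "X y \<in> interior P" for y
    using bij unfolding X_def bij_betw_def by (metis UNIV_I the_inv_into_into subset_refl)
  have gX: "grad u (X y) = y" for y
    using bij unfolding X_def bij_betw_def by (metis UNIV_I f_the_inv_into_f)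
  have Xg: "X (grad u x) = x" if "x \<in> interior P" for x
    using bij that unfolding X_def bij_betw_def by (metis the_inv_into_f_f)
  have dX: "(X has_derivative (\<lambda>h. matrix_inv (hess u (X y)) *v h)) (at y)" for y
  proof -
    have "(\<lambda>h. hess u (X y) *v h) \<circ> (\<lambda>h. matrix_inv (hess u (X y)) *v h) = id"
      using matrix_matrix_inv(1)[OF inv[OF Xin]]
      by (auto simp: o_def matrix_vector_mul_assoc)
    from has_derivative_inverse_on[where f' = "\<lambda>x h. hess u x *v h" and g = X and f = "grad u"
        and x = "X y" and g' = "\<lambda>x h. matrix_inv (hess u x) *v h",
        OF open_interior has_derivative_hess[OF diff2] Xg this Xin]
    show ?thesis by (simp add: gX)
  qed
  have dphi: "(legendre P u has_derivative (\<lambda>h. X y \<bullet> h)) (at y)" for y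
  proof -
    let ?D = "\<lambda>h. matrix_inv (hess u (X y)) *v h"
    have "((\<lambda>y. u (X y)) has_derivative (\<lambda>h. grad u (X y) \<bullet> ?D h)) (at y)"
      by (rule has_derivative_compose[OF dX has_derivative_grad[OF diff[OF Xin]]])
    then have "((\<lambda>y. y \<bullet> X y - u (X y)) has_derivative
        (\<lambda>h. (y \<bullet> ?D h + h \<bullet> X y) - grad u (X y) \<bullet> ?D h)) (at y)"
      by (intro derivative_intros dX)
    moreover have "legendre P u = (\<lambda>y. y \<bullet> X y - u (X y))"
      by (simp add: fun_eq_iff legendre_def X_def Let_def)
    ultimately show ?thesis by (simp add: gX inner_commute)
  qed
  have grad_phi: "grad (legendre P u) = X"
    using grad_unique[OF dphi] by blast
  show "twice_differentiable_at (legendre P u) y"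
    unfolding twice_differentiable_at_def grad_phi
    using dphi dX by (auto simp: differentiable_def intro!: always_eventually)
  show "hess (legendre P u) y = matrix_inv (hess u (X y))"
    by (rule hess_eqI) (simp add: grad_phi dX)
qed

section \<open>Derivatives of maxima with respect to a parameter\<close>

text \<open>
  Mean value theorem in \<open>s\<close>, for the function minus its linear part at the centre: the partial
  derivative is continuous in both variables, hence within \<open>e\<close> of its central value nearby.  The
  vector \<open>(1, 0)\<close> is the direction of \<open>s\<close>.
\<close>

lemma C1_imp_locally_uniform_partial_derivative:
  fixes g :: "real \<times> 'a::euclidean_space \<Rightarrow> real"
  assumes "open U" "(t, x\<^sub>0) \<in> U" "Ck_on 1 g U" "0 < e"
  shows "\<exists>\<delta>>0. \<forall>s x. \<bar>s - t\<bar> < \<delta> \<longrightarrow> dist x x\<^sub>0 < \<delta> \<longrightarrow> (s, x) \<in> U \<and>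
    \<bar>g (s, x) - g (t, x) - (s - t) * frechet_derivative g (at (t, x\<^sub>0)) (1, 0)\<bar> \<le> e * \<bar>s - t\<bar>"
proof -
  define p where "p z = frechet_derivative g (at z) (1, 0)" for z
  have "(1, 0) \<in> (Basis :: (real \<times> 'a) set)" by (simp add: Basis_prod_def)
  then have cont: "continuous_on U p" and diff: "\<And>z. z \<in> U \<Longrightarrow> g differentiable (at z)"
    using assms(3) unfolding p_def by auto
  have "isCont p (t, x\<^sub>0)"
    using cont assms continuous_on_eq_continuous_at by blast
  then obtain r\<^sub>1 where r1: "r\<^sub>1 > 0" "\<And>z. dist z (t, x\<^sub>0) < r\<^sub>1 \<Longrightarrow> dist (p z) (p (t, x\<^sub>0)) < e"
    using \<open>0 < e\<close> unfolding continuous_at_eps_delta by metis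
  obtain r\<^sub>2 where r2: "r\<^sub>2 > 0" "ball (t, x\<^sub>0) r\<^sub>2 \<subseteq> U"
    using assms(1,2) openE by blast
  define \<delta> where "\<delta> = min r\<^sub>1 r\<^sub>2 / 2"
  have near: "dist (s, x) (t, x\<^sub>0) < min r\<^sub>1 r\<^sub>2" if "\<bar>s - t\<bar> < \<delta>" "dist x x\<^sub>0 < \<delta>" for s x
  proof -
    have "dist (s, x) (t, x\<^sub>0) \<le> \<bar>s - t\<bar> + dist x x\<^sub>0"
      using sqrt_sum_squares_le_sum_abs[of "s - t" "dist x x\<^sub>0"]
      by (simp add: dist_Pair_Pair dist_real_def)
    then show ?thesis using that by (simp add: \<delta>_def)
  qed
  have inU: "(s, x) \<in> U" if "\<bar>s - t\<bar> < \<delta>" "dist x x\<^sub>0 < \<delta>" for s x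
    using near[OF that] r2 by (auto simp: dist_commute)
  have "\<bar>g (s, x) - g (t, x) - (s - t) * p (t, x\<^sub>0)\<bar> \<le> e * \<bar>s - t\<bar>"
    if s: "\<bar>s - t\<bar> < \<delta>" and x: "dist x x\<^sub>0 < \<delta>" for s x
  proof -
    have "norm ((g (s, x) - s * p (t, x\<^sub>0)) - (g (t, x) - t * p (t, x\<^sub>0))) \<le> e * norm (s - t)"
    proof (rule field_differentiable_bound[where S = "ball t \<delta>" and f = "\<lambda>r. g (r, x) - r * p (t, x\<^sub>0)" and f' = "\<lambda>r. p (r, x) - p (t, x\<^sub>0)"])
      fix r assume "r \<in> ball t \<delta>"
      then have r: "\<bar>r - t\<bar> < \<delta>" by (simp add: dist_real_def)
      have rU: "(r, x) \<in> U" using inU[OF r x] .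
      have G: "(g has_derivative frechet_derivative g (at (r, x))) (at (r, x))"
        using diff[OF rU] frechet_derivative_works by blast
      then have lin: "linear (frechet_derivative g (at (r, x)))"
        by (simp add: has_derivative_bounded_linear bounded_linear.linear)
      have "((\<lambda>r. (r, x)) has_derivative (\<lambda>k. (k, 0))) (at r)"
        by (auto intro!: derivative_eq_intros)
      from has_derivative_compose[OF this G]
      have "((\<lambda>r. g (r, x)) has_derivative (\<lambda>k. frechet_derivative g (at (r, x)) (k, 0))) (at r)" .
      moreover have "frechet_derivative g (at (r, x)) (k, 0) = p (r, x) * k" for k
        using linear_cmul[OF lin, of k "(1, 0)"] by (simp add: p_def)
      ultimately have "((\<lambda>r. g (r, x)) has_real_derivative p (r, x)) (at r)"
        by (simp add: has_field_derivative_def)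
      then have "((\<lambda>r. g (r, x) - r * p (t, x\<^sub>0)) has_real_derivative p (r, x) - p (t, x\<^sub>0)) (at r)"
        using DERIV_diff[OF _ DERIV_cmult_right[OF DERIV_ident]] by fastforce
      then show "((\<lambda>r. g (r, x) - r * p (t, x\<^sub>0)) has_field_derivative p (r, x) - p (t, x\<^sub>0)) (at r within ball t \<delta>)"
        by (rule has_field_derivative_at_within)
      show "norm (p (r, x) - p (t, x\<^sub>0)) \<le> e"
        using r1(2)[of "(r, x)"] near[OF r x] by (simp add: dist_real_def)
    qed (use s r1(1) r2(1) in \<open>auto simp: dist_real_def \<delta>_def abs_minus_commute\<close>)
    then show ?thesis by (simp add: algebra_simps)
  qed
  then show ?thesis
    using r1(1) r2(1) inU unfolding p_def by (intro exI[of _ \<delta>]) (simp add: \<delta>_def)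
qed

text \<open>
  Away from the unique maximizer \<open>X t\<close> the values of \<open>f t\<close> stay below the maximum by some
  \<open>d > 0\<close>, by compactness; a perturbation of size \<open>d / 3\<close> cannot move a maximizer there.
\<close>

lemma maximizer_tendsto:
  fixes f :: "real \<Rightarrow> 'a::metric_space \<Rightarrow> real"
  assumes "compact P" "continuous_on P (f t)" "t \<in> T"
    and X: "\<And>s. s \<in> T \<Longrightarrow> X s \<in> P"
    and max: "\<And>s z. s \<in> T \<Longrightarrow> z \<in> P \<Longrightarrow> f s z \<le> f s (X s)"
    and strict: "\<And>z. z \<in> P \<Longrightarrow> z \<noteq> X t \<Longrightarrow> f t z < f t (X t)"
    and unif: "\<And>e. 0 < e \<Longrightarrow> \<forall>\<^sub>F s in at t within T. \<forall>z\<in>P. \<bar>f s z - f t z\<bar> \<le> e"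
  shows "(X \<longlongrightarrow> X t) (at t within T)"
proof (rule tendstoI)
  fix e :: real assume "0 < e"
  let ?K = "P - ball (X t) e"
  have K: "compact ?K" by (simp add: assms(1) compact_diff)
  obtain d where d: "d > 0" "\<And>z. z \<in> ?K \<Longrightarrow> f t z \<le> f t (X t) - d"
  proof (cases "?K = {}")
    case True
    show ?thesis by (rule that[of 1]) (simp_all only: True empty_iff zero_less_one)
  next
    case False
    have "continuous_on ?K (f t)" using assms(2) Diff_subset by (rule continuous_on_subset)
    from continuous_attains_sup[OF K False this]
    obtain k where k: "k \<in> ?K" "\<And>z. z \<in> ?K \<Longrightarrow> f t z \<le> f t k" by blast
    moreover have "f t k < f t (X t)" using k \<open>0 < e\<close> by (intro strict) auto
    ultimately show ?thesis using that[of "f t (X t) - f t k"] by auto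
  qed
  have inT: "\<forall>\<^sub>F s in at t within T. s \<in> T"
    by (auto simp: eventually_at_topological)
  have "0 < d / 3" using d by simp
  from unif[OF this] inT show "\<forall>\<^sub>F s in at t within T. dist (X s) (X t) < e"
  proof eventually_elim
    case (elim s)
    show ?case
    proof (rule ccontr)
      assume "\<not> dist (X s) (X t) < e"
      then have "X s \<in> ?K" using X elim by (auto simp: dist_commute)
      from d(2)[OF this] have "f t (X s) \<le> f t (X t) - d" .
      moreover have "\<bar>f s (X s) - f t (X s)\<bar> \<le> d / 3" "\<bar>f s (X t) - f t (X t)\<bar> \<le> d / 3"
        using elim X \<open>t \<in> T\<close> by auto
      moreover have "f s (X t) \<le> f s (X s)" using max X elim \<open>t \<in> T\<close> by auto
      ultimately show False using d(1) by linarith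
    qed
  qed
qed

text \<open>
  By maximality,
  \<open>f s (X t) - f t (X t) \<le> f s (X s) - f t (X t) \<le> f s (X s) - f t (X s)\<close>,
  and both outer terms are \<open>(s - t) D\<close> up to \<open>e \<bar>s - t\<bar>\<close>, since \<open>X s\<close> is close to \<open>X t\<close>.
\<close>

lemma envelope_derivative:
  fixes f :: "real \<Rightarrow> 'a::metric_space \<Rightarrow> real"
  assumes "t \<in> T"
    and X: "\<And>s. s \<in> T \<Longrightarrow> X s \<in> P"
    and max: "\<And>s z. s \<in> T \<Longrightarrow> z \<in> P \<Longrightarrow> f s z \<le> f s (X s)"
    and lim: "(X \<longlongrightarrow> X t) (at t within T)"
    and unif: "\<And>e. 0 < e \<Longrightarrow> \<exists>\<delta>>0. \<forall>s\<in>T. \<forall>z\<in>P. \<bar>s - t\<bar> < \<delta> \<longrightarrow> dist z (X t) < \<delta> \<longrightarrow>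
      \<bar>f s z - f t z - (s - t) * D\<bar> \<le> e * \<bar>s - t\<bar>"
  shows "((\<lambda>s. f s (X s)) has_real_derivative D) (at t within T)"
  unfolding has_field_derivative_iff
proof (rule tendstoI)
  fix e :: real assume "0 < e"
  then have "0 < e / 2" by simp
  from unif[OF this] obtain \<delta> where \<delta>: "\<delta> > 0"
    "\<And>s z. s \<in> T \<Longrightarrow> z \<in> P \<Longrightarrow> \<bar>s - t\<bar> < \<delta> \<Longrightarrow> dist z (X t) < \<delta> \<Longrightarrow>
      \<bar>f s z - f t z - (s - t) * D\<bar> \<le> e / 2 * \<bar>s - t\<bar>" by blast
  have "\<forall>\<^sub>F s in at t within T. s \<in> T \<and> s \<noteq> t \<and> \<bar>s - t\<bar> < \<delta>"
    unfolding eventually_at using \<delta>(1) by (auto simp: dist_real_def)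
  then show "\<forall>\<^sub>F s in at t within T. dist ((f s (X s) - f t (X t)) / (s - t)) D < e"
    using tendstoD[OF lim \<delta>(1)]
  proof eventually_elim
    case (elim s)
    define q where "q = f s (X s) - f t (X t)"
    have "\<bar>f s (X s) - f t (X s) - (s - t) * D\<bar> \<le> e / 2 * \<bar>s - t\<bar>"
      using elim X by (intro \<delta>(2)) auto
    moreover have "\<bar>f s (X t) - f t (X t) - (s - t) * D\<bar> \<le> e / 2 * \<bar>s - t\<bar>"
      using elim X \<delta>(1) \<open>t \<in> T\<close> by (intro \<delta>(2)) auto
    moreover have "f s (X t) \<le> f s (X s)" "f t (X s) \<le> f t (X t)"
      using max X elim \<open>t \<in> T\<close> by auto
    ultimately have "\<bar>q - (s - t) * D\<bar> \<le> e / 2 * \<bar>s - t\<bar>"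
      unfolding q_def by linarith
    also have "\<dots> < e * \<bar>s - t\<bar>" using elim \<open>0 < e\<close> by simp
    finally have "\<bar>q - (s - t) * D\<bar> / \<bar>s - t\<bar> < e"
      using elim by (simp add: field_simps)
    moreover have "\<bar>q - (s - t) * D\<bar> / \<bar>s - t\<bar> = \<bar>q / (s - t) - D\<bar>"
      using elim by (simp add: divide_simps mult.commute flip: abs_divide)
    ultimately show ?case by (simp add: q_def dist_real_def)
  qed
qed

section \<open>The flow of the Legendre transforms\<close>

theorem proposition4p2:
  fixes \<Lambda> :: "(real^'m) set" and d :: nat and v :: "nat \<Rightarrow> real^'m" and lam :: "nat \<Rightarrow> real"
    and A\<^sub>0 B\<^sub>0 :: "real^'m^'m" and T :: "real set"
    and u :: "real \<Rightarrow> real^'m \<Rightarrow> real" and A B :: "real \<Rightarrow> real^'m^'m"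
    and \<phi> :: "real \<Rightarrow> real^'m \<Rightarrow> real"
  assumes "delzant \<Lambda> d v lam"
    and "fano_normalized d v lam"
    and "skew_symmetric A\<^sub>0" and "skew_symmetric B\<^sub>0"
    and "is_interval T" and "interior T \<noteq> {}"
    and "flow_solution d v lam A\<^sub>0 B\<^sub>0 T u A B"
    and "\<And>t. \<phi> t = legendre (labelled_polytope d v lam) (u t)"
  shows "\<forall>t\<in>T. \<forall>y.
    twice_differentiable_at (\<phi> t) y \<and>
    invertible (hess (\<phi> t) y) \<and>
    hermitian_pos_def (complex_mat (matrix_inv (hess (\<phi> t) y)) (exp (- 2 * t) *\<^sub>R B\<^sub>0)) \<and>
    ((\<lambda>s. \<phi> s y) has_real_derivative
       log_det (matrix_inv (complex_mat (matrix_inv (hess (\<phi> t) y)) (exp (- 2 * t) *\<^sub>R B\<^sub>0)))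
       + 2 * \<phi> t y) (at t within T)"
proof (intro ballI allI)
  fix t y assume t: "t \<in> T"
  let ?P = "labelled_polytope d v lam"
  let ?M = "\<lambda>s x. complex_mat (hess (u s) x) (exp (- 2 * s) *\<^sub>R B\<^sub>0)"
  define X where "X s = the_inv_into (interior ?P) (grad (u s)) y" for s
  define f where "f s z = y \<bullet> z - u s z" for s z
  have cpt: "compact ?P"
    using assms(1) unfolding delzant_def Let_def by blast
  have ne: "interior ?P \<noteq> {}"
    using zero_in_interior_labelled_polytope[OF assms(2)] by blast
  have path: "smooth_path_of_potentials d v lam T u"
    and posdef: "\<And>s x. s \<in> T \<Longrightarrow> x \<in> interior ?P \<Longrightarrow> hermitian_pos_def (?M s x)"
    and flow: "\<And>s x. s \<in> T \<Longrightarrow> x \<in> interior ?P \<Longrightarrow> ((\<lambda>r. u r x) has_real_derivative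
        log_det (?M s x) - 2 * (- u s x + (\<Sum>j\<in>UNIV. x $ j * grad (u s) x $ j))) (at s within T)"
    using assms(7) unfolding flow_solution_def by blast+
  have pot: "\<And>s. s \<in> T \<Longrightarrow> u s \<in> symplectic_potentials d v lam"
    and smooth: "smooth_on (T \<times> ?P) (\<lambda>(s, x). u s x - guillemin d v lam x)"
    using path unfolding smooth_path_of_potentials_def by blast+
  note bij = grad_bij_maximizer(1)[OF cpt assms(2) pot]
  have Xin: "X s \<in> interior ?P" and gX: "grad (u s) (X s) = y" if "s \<in> T" for s
    using bij[OF that] the_inv_into_into[of "grad (u s)" "interior ?P" y "interior ?P"]
      f_the_inv_into_f[of "grad (u s)" "interior ?P" y]
    by (auto simp: X_def bij_betw_def)
  then have XP: "X s \<in> ?P" if "s \<in> T" for s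
    using that interior_subset by blast
  have strict: "f s z < f s (X s)" if "s \<in> T" "z \<in> ?P" "z \<noteq> X s" for s z
    using grad_bij_maximizer(2)[OF cpt assms(2) pot[OF that(1)] Xin[OF that(1)] that(2,3)]
    by (simp add: f_def gX[OF that(1)])
  then have max: "f s z \<le> f s (X s)" if "s \<in> T" "z \<in> ?P" for s z
    using that by (cases "z = X s") (auto intro: less_imp_le)
  have phi: "\<phi> s y = f s (X s)" for s
    by (simp add: assms(8) legendre_def Let_def X_def f_def)

  note diff = smooth_on_imp_twice_differentiable[OF open_interior
      symplectic_potential_interior(1)[OF pot[OF t] ne]]
  note inv = hermitian_pos_def_complex_mat_invertible[OF posdef[OF t]]
  have second: "twice_differentiable_at (\<phi> t) y" "hess (\<phi> t) y = matrix_inv (hess (u t) (X t))"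
    using legendre_second_order[OF bij[OF t] diff inv] by (simp_all add: assms(8) X_def)
  note inv_hess = matrix_inv_matrix_inv[OF inv[OF Xin[OF t]]]

  have lim: "(X \<longlongrightarrow> X t) (at t within T)"
  proof (rule maximizer_tendsto[where f = f and X = X, OF cpt _ t XP max strict[OF t]])
    have "continuous_on ?P (u t)"
      using pot[OF t] by (simp add: symplectic_potentials_def Let_def)
    then show "continuous_on ?P (f t)"
      unfolding f_def by (intro continuous_intros)
    fix e :: real assume "0 < e"
    obtain N where N: "t \<in> N" "open N" "\<forall>s\<in>N \<inter> T. \<forall>z\<in>?P.
        dist ((\<lambda>(s, x). u s x - guillemin d v lam x) (s, z))
             ((\<lambda>(s, x). u s x - guillemin d v lam x) (t, z)) \<le> e"
      using continuous_on_prod_compactE[OF smooth_on_imp_continuous_on[OF smooth] cpt t \<open>0 < e\<close>]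
      by blast
    then have "\<forall>s\<in>N \<inter> T. \<forall>z\<in>?P. \<bar>f s z - f t z\<bar> \<le> e"
      by (simp add: f_def dist_real_def abs_minus_commute)
    with N(1,2) show "\<forall>\<^sub>F s in at t within T. \<forall>z\<in>?P. \<bar>f s z - f t z\<bar> \<le> e"
      unfolding eventually_at_topological by blast
  qed

  \<comment> \<open>\<open>g\<close> extends \<open>u - guillemin\<close> smoothly to both sides of \<open>t\<close>, also at an end point of \<open>T\<close>\<close>
  obtain U g where U: "open U" "(t, X t) \<in> U" and g: "\<And>k. Ck_on k g U"
    and eq: "\<And>s z. (s, z) \<in> U \<Longrightarrow> s \<in> T \<Longrightarrow> z \<in> ?P \<Longrightarrow> g (s, z) = u s z - guillemin d v lam z"
  proof -
    have "(t, X t) \<in> T \<times> ?P" using t XP by blast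
    from smooth[unfolded smooth_on_def, rule_format, OF this]
    obtain U g where "open U" "(t, X t) \<in> U" "\<forall>k. Ck_on k g U"
      "\<forall>z\<in>U \<inter> T \<times> ?P. g z = (case z of (s, x) \<Rightarrow> u s x - guillemin d v lam x)" by blast
    then show ?thesis by (intro that[of U g]) auto
  qed
  define D where "D = frechet_derivative g (at (t, X t)) (1, 0)"
  have unif: "\<exists>\<delta>>0. \<forall>s\<in>T. \<forall>z\<in>?P. \<bar>s - t\<bar> < \<delta> \<longrightarrow> dist z (X t) < \<delta> \<longrightarrow>
      \<bar>u s z - u t z - (s - t) * D\<bar> \<le> e * \<bar>s - t\<bar>" if "0 < e" for e
  proof -
    obtain \<delta> where \<delta>: "\<delta> > 0" and *: "\<And>s z. \<bar>s - t\<bar> < \<delta> \<Longrightarrow> dist z (X t) < \<delta> \<Longrightarrow> (s, z) \<in> U \<and>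
        \<bar>g (s, z) - g (t, z) - (s - t) * D\<bar> \<le> e * \<bar>s - t\<bar>"
      using C1_imp_locally_uniform_partial_derivative[OF U g \<open>0 < e\<close>] unfolding D_def by blast
    have "\<bar>u s z - u t z - (s - t) * D\<bar> \<le> e * \<bar>s - t\<bar>"
      if s: "s \<in> T" and z: "z \<in> ?P" and near: "\<bar>s - t\<bar> < \<delta>" "dist z (X t) < \<delta>" for s z
    proof -
      have "(t, z) \<in> U" using *[of t z] near \<delta> by simp
      then show ?thesis
        using *[OF near] eq[OF _ s z] eq[OF _ t z] by simp
    qed
    then show ?thesis using \<delta> by blast
  qed

  \<comment> \<open>with a single competitor the envelope principle is plain differentiability in time;
    it identifies \<open>D\<close> with the right-hand side of the flow\<close>
  have dD: "((\<lambda>s. u s (X t)) has_real_derivative D) (at t within T)"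
  proof (rule envelope_derivative[where f = u and P = "{X t}" and X = "\<lambda>s. X t"])
    show "\<exists>\<delta>>0. \<forall>s\<in>T. \<forall>z\<in>{X t}. \<bar>s - t\<bar> < \<delta> \<longrightarrow> dist z (X t) < \<delta> \<longrightarrow>
      \<bar>u s z - u t z - (s - t) * D\<bar> \<le> e * \<bar>s - t\<bar>" if "0 < e" for e
      using unif[OF that] XP[OF t] by blast
  qed (use t in auto)
  have "at t within T \<noteq> bot"
  proof -
    have "\<nexists>a. T = {a}" using assms(6) by auto
    then have "t islimpt T"
      using connected_imp_perfect[of T t] t assms(5) is_interval_connected by blast
    then show ?thesis using trivial_limit_within by blast
  qed
  then have D: "D = log_det (?M t (X t)) - 2 * (- u t (X t) + (\<Sum>j\<in>UNIV. X t $ j * grad (u t) (X t) $ j))"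
    by (rule has_field_derivative_unique[OF dD flow[OF t Xin[OF t]]])
  have "(\<Sum>j\<in>UNIV. X t $ j * grad (u t) (X t) $ j) = y \<bullet> X t"
    by (simp add: gX[OF t] inner_vec_def mult.commute)
  then have rhs: "- D = log_det (matrix_inv (?M t (X t))) + 2 * \<phi> t y"
    unfolding D log_det_matrix_inv[OF posdef[OF t Xin[OF t]]] phi f_def by simp
  have "((\<lambda>s. f s (X s)) has_real_derivative - D) (at t within T)"
  proof (rule envelope_derivative[where f = f and X = X, OF t XP max lim])
    have "f s z - f t z - (s - t) * - D = - (u s z - u t z - (s - t) * D)" for s z
      by (simp add: f_def)
    then show "\<exists>\<delta>>0. \<forall>s\<in>T. \<forall>z\<in>?P. \<bar>s - t\<bar> < \<delta> \<longrightarrow> dist z (X t) < \<delta> \<longrightarrow>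
      \<bar>f s z - f t z - (s - t) * - D\<bar> \<le> e * \<bar>s - t\<bar>" if "0 < e" for e
      using unif[OF that] by (simp only: abs_minus_cancel)
  qed
  then have "((\<lambda>s. \<phi> s y) has_real_derivative - D) (at t within T)"
    by (simp add: phi)
  then show "twice_differentiable_at (\<phi> t) y \<and>
    invertible (hess (\<phi> t) y) \<and>
    hermitian_pos_def (complex_mat (matrix_inv (hess (\<phi> t) y)) (exp (- 2 * t) *\<^sub>R B\<^sub>0)) \<and>
    ((\<lambda>s. \<phi> s y) has_real_derivative
       log_det (matrix_inv (complex_mat (matrix_inv (hess (\<phi> t) y)) (exp (- 2 * t) *\<^sub>R B\<^sub>0)))
       + 2 * \<phi> t y) (at t within T)"
    using second(1) inv_hess posdef[OF t Xin[OF t]]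
    unfolding second(2) inv_hess(2) rhs by blast
qed

end
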